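(* For every integer $k\ge 0$, the graph $B_k$ is a series-parallel broadcast graph on $2^k+1$ vertices.
   Context: The binomial tree $BT_0$ is a single vertex (its root); for $k\ge1$, $BT_k$ is obtained from two disjoint copies of $BT_{k-1}$ by adding an edge between their roots, one of which is designated the root of $BT_k$; $BT_k$ has $2^k$ vertices. The graph $B_k$ is obtained from $BT_k$ with root $s$ by adding a new vertex $t$ adjacent to all $2^k$ vertices of $BT_k$. A multigraph is series-parallel (SP) if it can be obtained from $K_2$ by a finite sequence of series extensions (replace an edge $\{x,y\}$ by a new vertex $z$ and edges $\{x,z\},\{z,y\}$) and parallel extensions (add an edge parallel to an existing edge); a simple graph is SP if it is the result of such a sequence with no multiple edges at the end. Broadcasting: initially only an originator holds a message; in each discrete time unit, every informed vertex may inform at most one uninformed neighbor. $b(v,G)$ is the minimum number of time units to inform all vertices from originator $v$, $b(G)=\max_v b(v,G)$, and a connected graph on $n$ vertices is a broadcast graph if $b(G)=\lceil\log_2 n\rceil$. *)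

theory Defs
  imports Complex_Main "HOL-Library.Multiset"
begin

type_synonym 'v ugraph = "'v set \<times> 'v set set"

abbreviation verts :: "'v ugraph \<Rightarrow> 'v set" where "verts G \<equiv> fst G"
abbreviation edges :: "'v ugraph \<Rightarrow> 'v set set" where "edges G \<equiv> snd G"

definition simple_graph :: "'v ugraph \<Rightarrow> bool" where
  "simple_graph G \<longleftrightarrow> finite (verts G) \<and> verts G \<noteq> {} \<and>
     (\<forall>e \<in> edges G. \<exists>x \<in> verts G. \<exists>y \<in> verts G. x \<noteq> y \<and> e = {x, y})"

definition connected_graph :: "'v ugraph \<Rightarrow> bool" where
  "connected_graph G \<longleftrightarrow>
     (\<forall>u \<in> verts G. \<forall>v \<in> verts G. (u, v) \<in> {(x, y). {x, y} \<in> edges G}\<^sup>*)"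

definition map_graph :: "('v \<Rightarrow> 'w) \<Rightarrow> 'v ugraph \<Rightarrow> 'w ugraph" where
  "map_graph f G = (f ` verts G, (\<lambda>e. f ` e) ` edges G)"

(* The two disjoint copies of the previous tree are tagged by the head of the list;
   the root of the copy tagged False is the designated root. *)

primrec binomial_root :: "nat \<Rightarrow> bool list" where
  "binomial_root 0 = []"
| "binomial_root (Suc k) = False # binomial_root k"

primrec binomial_tree :: "nat \<Rightarrow> bool list ugraph" where
  "binomial_tree 0 = ({[]}, {})"
| "binomial_tree (Suc k) =
     (let G = map_graph (Cons False) (binomial_tree k);
          H = map_graph (Cons True) (binomial_tree k)
      in (verts G \<union> verts H,
          edges G \<union> edges H \<union> {{False # binomial_root k, True # binomial_root k}}))"

(* None is the additional vertex t. *)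

definition B_graph :: "nat \<Rightarrow> bool list option ugraph" where
  "B_graph k = (let T = map_graph Some (binomial_tree k)
          in (insert None (verts T), edges T \<union> {{None, x} | x. x \<in> verts T}))"

(* A loopless multigraph is given by its vertex set and its multiset of edges. *)

inductive sp_multigraph :: "'v set \<Rightarrow> 'v set multiset \<Rightarrow> bool" where
  K2: "x \<noteq> y \<Longrightarrow> sp_multigraph {x, y} {#{x, y}#}"
| series: "sp_multigraph V M \<Longrightarrow> {x, y} \<in># M \<Longrightarrow> z \<notin> V \<Longrightarrow>
     sp_multigraph (insert z V) (M - {#{x, y}#} + {#{x, z}, {z, y}#})"
| parallel: "sp_multigraph V M \<Longrightarrow> e \<in># M \<Longrightarrow> sp_multigraph V (add_mset e M)"

(* mset_set gives every edge multiplicity one. Intermediate multigraphs of the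
   construction may have multiple edges. *)

definition series_parallel :: "'v ugraph \<Rightarrow> bool" where
  "series_parallel G \<longleftrightarrow> simple_graph G \<and> sp_multigraph (verts G) (mset_set (edges G))"

(* informed_after G v n I: some broadcast from v has I as its set of informed
   vertices after n time units. C is the set of calls (caller, callee) of a time unit. *)

inductive informed_after :: "'v ugraph \<Rightarrow> 'v \<Rightarrow> nat \<Rightarrow> 'v set \<Rightarrow> bool" for G v where
  start: "informed_after G v 0 {v}"
| round: "informed_after G v n I \<Longrightarrow> single_valued C \<Longrightarrow>
     (\<forall>(x, y) \<in> C. x \<in> I \<and> y \<in> verts G - I \<and> {x, y} \<in> edges G) \<Longrightarrow>
     informed_after G v (Suc n) (I \<union> Range C)"

(* Meaningful for connected graphs only: otherwise no n qualifies. *)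

definition broadcast_time_from :: "'v \<Rightarrow> 'v ugraph \<Rightarrow> nat" where
  "broadcast_time_from v G = (LEAST n. informed_after G v n (verts G))"

definition broadcast_time :: "'v ugraph \<Rightarrow> nat" where
  "broadcast_time G = Max ((\<lambda>v. broadcast_time_from v G) ` verts G)"

definition broadcast_graph :: "'v ugraph \<Rightarrow> bool" where
  "broadcast_graph G \<longleftrightarrow> simple_graph G \<and> connected_graph G \<and>
     int (broadcast_time G) = \<lceil>log 2 (real (card (verts G)))\<rceil>"

end

theory Submission
  imports Defs
begin

text \<open>
  Growing a tree by a leaf \<open>z\<close> at \<open>x\<close> changes its cone with apex \<open>t\<close> by doubling the edge
  \<open>{x, t}\<close> and subdividing one of the two copies by \<open>z\<close>; hence the cone over any tree is
  series-parallel.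

  For broadcasting, label the tree by the Boolean words of length \<open>k\<close>, so that \<open>u @ False\<^sup>j\<close>
  is the root of the copy of \<open>BT\<^sub>j\<close> with prefix \<open>u\<close>. An originator \<open>v\<close> in the tree first
  calls \<open>t\<close>. The other tree vertices split into copies of \<open>BT\<^bsub>k-1\<^esub>, \<dots>, BT\<^sub>0\<close>, given by the
  first position where they differ from \<open>v\<close>; in this order \<open>t\<close> calls their roots, and each copy has
  just enough rounds left to broadcast from its root. The originator \<open>t\<close> first calls
  \<open>s\<close>, which broadcasts in its tree. As the informed set at most doubles in a round,
  \<open>k + 1\<close> rounds are optimal.
\<close>

section \<open>Cones over trees\<close>

text \<open>Trees grow leaf by leaf, since one new leaf costs the cone one parallel and one series
  extension. The root is recorded because binomial trees are joined at their roots.\<close>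

inductive rooted_tree :: "'v \<Rightarrow> 'v set \<Rightarrow> 'v set set \<Rightarrow> bool" for r where
  single: "rooted_tree r {r} {}"
| leaf: "rooted_tree r V E \<Longrightarrow> x \<in> V \<Longrightarrow> z \<notin> V \<Longrightarrow> rooted_tree r (insert z V) (insert {x, z} E)"

lemma rooted_tree_image:
  assumes "rooted_tree r V E" and "inj f"
  shows "rooted_tree (f r) (f ` V) ((`) f ` E)"
  using assms(1)
proof induction
  case single
  show ?case by (simp add: rooted_tree.single)
next
  case (leaf V E x z)
  have "rooted_tree (f r) (insert (f z) (f ` V)) (insert {f x, f z} ((`) f ` E))"
    by (rule rooted_tree.leaf) (use leaf assms(2) in \<open>auto simp: inj_image_mem_iff\<close>)
  then show ?case by simp
qed

text \<open>The second tree can be regrown on top of the first: \<open>r'\<close> is attached as a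
  leaf at \<open>x\<close>, and the other vertices follow in their own order. Disjointness keeps
  each of them fresh.\<close>

lemma rooted_tree_join:
  assumes "rooted_tree r' V' E'" and "rooted_tree r V E" and "V \<inter> V' = {}" and "x \<in> V"
  shows "rooted_tree r (V \<union> V') (E \<union> E' \<union> {{x, r'}})"
  using assms
proof induction
  case single
  then show ?case using rooted_tree.leaf[of r V E x r'] by auto
next
  case (leaf V' E' y z)
  then have "rooted_tree r (insert z (V \<union> V')) (insert {y, z} (E \<union> E' \<union> {{x, r'}}))"
    by (intro rooted_tree.leaf) auto
  then show ?case by (simp add: insert_commute)
qed

lemma rooted_tree_root: "rooted_tree r V E \<Longrightarrow> r \<in> V"
  by (induction rule: rooted_tree.induct) auto

lemma rooted_tree_finite:
  assumes "rooted_tree r V E"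
  shows "finite V" and "finite E"
  using assms by (induction rule: rooted_tree.induct) auto

lemma rooted_tree_edge:
  assumes "rooted_tree r V E" and "e \<in> E"
  shows "\<exists>x\<in>V. \<exists>y\<in>V. x \<noteq> y \<and> e = {x, y}"
  using assms
proof induction
  case (leaf V E x z)
  then consider "e = {x, z}" | "e \<in> E" by blast
  then show ?case
  proof cases
    case 1
    with leaf.hyps show ?thesis by (intro bexI[of _ x] bexI[of _ z]) auto
  next
    case 2
    with leaf.IH show ?thesis by (meson insertI2)
  qed
qed simp

lemma sp_multigraph_cone:
  assumes "rooted_tree r V E" and "t \<notin> V"
  shows "sp_multigraph (insert t V) (mset_set (E \<union> (\<lambda>x. {t, x}) ` V))"
  using assms
proof induction
  case single
  then show ?case using sp_multigraph.K2[of t r] by simp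
next
  case (leaf V E x z)
  define F where "F = E \<union> (\<lambda>y. {t, y}) ` V"
  have fin: "finite F"
    using rooted_tree_finite[OF leaf.hyps(1)] by (simp add: F_def)
  have z: "z \<notin> insert t V" and "x \<noteq> t"
    using leaf.hyps leaf.prems by auto
  \<comment> \<open>Both new edges contain the fresh vertex \<open>z\<close>, so neither lies in
    \<open>F\<close>; otherwise \<open>mset_set\<close> would lose a multiplicity below.\<close>
  have "z \<notin> e" if "e \<in> F" for e
    using that z rooted_tree_edge[OF leaf.hyps(1), of e] unfolding F_def by fastforce
  then have not_in_F: "{z, t} \<notin> F" "{x, z} \<notin> F"
    by fastforce+
  have "{x, z} \<noteq> {z, t}"
    using z \<open>x \<noteq> t\<close> by (simp add: doubleton_eq_iff)
  with not_in_F have new: "{x, z} \<notin> insert {z, t} F"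
    by (simp only: insert_iff simp_thms)
  have "{t, x} \<in> F"
    unfolding F_def using leaf.hyps(2) by (intro UnI2 imageI)
  then have xt: "{x, t} \<in># mset_set F"
    unfolding insert_commute[of x t] using fin by (simp only: finite_set_mset_mset_set)
  have "sp_multigraph (insert t V) (mset_set F)"
    unfolding F_def using leaf by simp
  from sp_multigraph.parallel[OF this xt]
  have "sp_multigraph (insert z (insert t V))
      (add_mset {x, t} (mset_set F) - {#{x, t}#} + {#{x, z}, {z, t}#})"
    by (rule sp_multigraph.series) (use z in simp_all)
  \<comment> \<open>The series extension consumes only the doubled copy, so \<open>{x, t}\<close>
    survives exactly once.\<close>
  also have "add_mset {x, t} (mset_set F) - {#{x, t}#} + {#{x, z}, {z, t}#} =
      mset_set (insert {x, z} (insert {z, t} F))"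
    using fin not_in_F(1) new by (simp del: insert_iff)
  also have "insert {x, z} (insert {z, t} F) = insert {x, z} E \<union> (\<lambda>y. {t, y}) ` insert z V"
    unfolding F_def image_insert insert_commute[of z t "{}"] Un_insert_right Un_insert_left
    by (rule insert_commute)
  finally show ?case unfolding insert_commute[of z t V] .
qed

lemma simple_graph_cone:
  assumes "rooted_tree r V E" and "t \<notin> V"
  shows "simple_graph (insert t V, E \<union> (\<lambda>x. {t, x}) ` V)"
proof -
  have edge: "\<exists>x \<in> insert t V. \<exists>y \<in> insert t V. x \<noteq> y \<and> e = {x, y}"
    if "e \<in> E \<union> (\<lambda>x. {t, x}) ` V" for e
    using that
  proof
    assume "e \<in> E"
    from rooted_tree_edge[OF assms(1) this] show ?thesis by (meson insertI2)
  next
    assume "e \<in> (\<lambda>x. {t, x}) ` V"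
    then obtain x where "x \<in> V" "e = {t, x}" by blast
    with assms(2) show ?thesis by (intro bexI[of _ t] bexI[of _ x]) auto
  qed
  have "finite (insert t V)"
    using rooted_tree_finite(1)[OF assms(1)] by simp
  then show ?thesis
    unfolding simple_graph_def fst_conv snd_conv
    by (intro conjI ballI insert_not_empty edge)
qed

lemma connected_graph_cone:
  assumes "\<And>x. x \<in> V \<Longrightarrow> {t, x} \<in> E"
  shows "connected_graph (insert t V, E)"
proof -
  let ?R = "{(x, y). {x, y} \<in> E}"
  have via: "(u, t) \<in> ?R\<^sup>*" "(t, u) \<in> ?R\<^sup>*" if "u \<in> insert t V" for u
  proof -
    have "u = t \<or> (u, t) \<in> ?R \<and> (t, u) \<in> ?R"
      using that assms[of u] by (auto simp: insert_commute[of u t "{}"])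
    then show "(u, t) \<in> ?R\<^sup>*" "(t, u) \<in> ?R\<^sup>*"
      by (metis r_into_rtrancl rtrancl.rtrancl_refl)+
  qed
  show ?thesis
    unfolding connected_graph_def fst_conv snd_conv
    by (intro ballI rtrancl_trans[OF via(1) via(2)])
qed

section \<open>Binomial trees\<close>

lemma binomial_root_eq: "binomial_root k = replicate k False"
  by (induction k) auto

lemma verts_binomial_tree: "verts (binomial_tree k) = {w. length w = k}"
  by (induction k) (auto simp: map_graph_def Let_def length_Suc_conv image_iff)

lemma rooted_tree_binomial_tree:
  "rooted_tree (binomial_root k) (verts (binomial_tree k)) (edges (binomial_tree k))"
proof (induction k)
  case 0
  show ?case by (simp add: rooted_tree.single)
next
  case (Suc k)
  have copy: "rooted_tree (b # binomial_root k) (Cons b ` verts (binomial_tree k))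
      ((`) (Cons b) ` edges (binomial_tree k))" for b
    using rooted_tree_image[OF Suc, of "Cons b"] by simp
  show ?case
    using rooted_tree_join[OF copy[of True] copy[of False]] rooted_tree_root[OF Suc]
    by (auto simp: map_graph_def Let_def)
qed

text \<open>Each edge of this form joins the roots of the two halves of the copy of order
  \<open>Suc j\<close> with prefix \<open>w\<close>. The induction strips the tags of
  \<open>w\<close> one by one until this edge is the outermost one.\<close>

lemma edge_binomial_tree:
  assumes "length w + Suc j = k"
  shows "{w @ False # replicate j False, w @ True # replicate j False} \<in> edges (binomial_tree k)"
  using assms
proof (induction k arbitrary: w)
  case 0
  then show ?case by simp
next
  case (Suc k)
  show ?case
  proof (cases w)
    case Nil
    with Suc.prems show ?thesis by (simp add: Let_def binomial_root_eq)
  next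
    case (Cons b u)
    let ?e = "{u @ False # replicate j False, u @ True # replicate j False}"
    have "(#) b ` ?e \<in> (`) ((#) b) ` edges (binomial_tree k)"
      using Suc Cons by (intro imageI) simp
    with Cons show ?thesis by (cases b) (auto simp: Let_def map_graph_def)
  qed
qed

lemma verts_B_graph: "verts (B_graph k) = insert None (Some ` {w. length w = k})"
  by (simp add: B_graph_def Let_def map_graph_def verts_binomial_tree)

lemma B_graph_cone:
  obtains r V E where "rooted_tree r V E" and "None \<notin> V"
    and "B_graph k = (insert None V, E \<union> (\<lambda>x. {None, x}) ` V)"
  using rooted_tree_image[OF rooted_tree_binomial_tree, of Some k]
  by (auto simp: B_graph_def Let_def map_graph_def Setcompr_eq_image)

lemma card_verts_B_graph: "card (verts (B_graph k)) = 2 ^ k + 1"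
proof -
  have "card {w :: bool list. length w = k} = 2 ^ k" "finite {w :: bool list. length w = k}"
    using card_lists_length_eq[of "UNIV :: bool set" k]
      finite_lists_length_eq[of "UNIV :: bool set" k] by simp_all
  then show ?thesis
    by (simp add: verts_B_graph card_insert_if card_image)
qed

lemma apex_edge_B_graph: "length w = k \<Longrightarrow> {None, Some w} \<in> edges (B_graph k)"
  by (auto simp: B_graph_def Let_def map_graph_def verts_binomial_tree)

lemma tree_edge_B_graph:
  assumes "length u < k"
  shows "{Some (u @ replicate (k - length u) False),
      Some (u @ True # replicate (k - Suc (length u)) False)} \<in> edges (B_graph k)"
proof -
  obtain j where j: "k = length u + Suc j"
    using assms less_iff_Suc_add by auto
  have "Some ` {u @ False # replicate j False, u @ True # replicate j False} \<in> edges (B_graph k)"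
    using edge_binomial_tree[of u j k] j
    unfolding B_graph_def Let_def map_graph_def by (simp del: image_insert)
  then show ?thesis by (simp add: j del: binomial_tree.simps)
qed

section \<open>Broadcasting\<close>

lemma card_informed_after:
  assumes "informed_after G v n I"
  shows "finite I \<and> card I \<le> 2 ^ n"
  using assms
proof induction
  case start
  show ?case by simp
next
  case (round n I C)
  \<comment> \<open>\<open>?f\<close> sends a caller to its only callee. Its unspecified value at
    idle vertices is harmless, as only an inclusion of \<open>Range C\<close> is needed.\<close>
  let ?f = "\<lambda>x. THE y. (x, y) \<in> C"
  have "?f x = y" if "(x, y) \<in> C" for x y
    using that round.hyps(2) by (auto dest: single_valuedD)
  then have sub: "Range C \<subseteq> ?f ` I"
    using round.hyps(3) by force
  then have "card (Range C) \<le> card I"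
    using round.IH by (meson card_image_le card_mono finite_imageI le_trans)
  moreover have "finite (Range C)"
    using sub round.IH by (meson finite_imageI finite_subset)
  ultimately show ?case
    using round.IH card_Un_le[of I "Range C"] by simp
qed

lemma informed_after_round:
  assumes "informed_after G v n I" and "single_valued C"
    and "\<And>x y. (x, y) \<in> C \<Longrightarrow> x \<in> I \<and> y \<in> verts G \<and> {x, y} \<in> edges G"
  shows "informed_after G v (Suc n) (I \<union> Range C)"
proof -
  let ?C = "{(x, y) \<in> C. y \<notin> I}"
  have "informed_after G v (Suc n) (I \<union> Range ?C)"
    by (rule informed_after.round[OF assms(1)])
      (use assms in \<open>auto simp: single_valued_def\<close>)
  also have "I \<union> Range ?C = I \<union> Range C" by auto
  finally show ?thesis .
qed

text \<open>In one round the root of each copy with prefix in \<open>U\<close> calls the root of its upper half,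
  and the apex calls \<open>w\<close>.\<close>

lemma informed_after_B_graph_round:
  assumes inf: "informed_after (B_graph k) a n (insert None (Some ` S))"
    and S: "(\<lambda>u. u @ replicate (k - m) False) ` U \<subseteq> S"
    and U: "\<And>u. u \<in> U \<Longrightarrow> length u = m" and "m < k" and w: "length w = k"
  shows "informed_after (B_graph k) a (Suc n)
    (insert None (Some ` (insert w (S \<union> (\<lambda>u. u @ True # replicate (k - Suc m) False) ` U))))"
proof -
  let ?C = "insert (None, Some w)
    ((\<lambda>u. (Some (u @ replicate (k - m) False), Some (u @ True # replicate (k - Suc m) False))) ` U)"
  have "informed_after (B_graph k) a (Suc n) (insert None (Some ` S) \<union> Range ?C)"
  proof (rule informed_after_round[OF inf])
    \<comment> \<open>All words of \<open>U\<close> get the same suffix, so a caller determines its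
      prefix \<open>u\<close>.\<close>
    show "single_valued ?C" by (auto simp: single_valued_def)
  next
    fix x y
    assume xy: "(x, y) \<in> ?C"
    show "x \<in> insert None (Some ` S) \<and> y \<in> verts (B_graph k) \<and> {x, y} \<in> edges (B_graph k)"
    proof (cases x)
      case None
      with xy w show ?thesis by (auto simp: verts_B_graph apex_edge_B_graph)
    next
      case (Some z)
      with xy obtain u where u: "u \<in> U" "x = Some (u @ replicate (k - m) False)"
        "y = Some (u @ True # replicate (k - Suc m) False)" by auto
      with U[of u] S \<open>m < k\<close> tree_edge_B_graph[of u k] show ?thesis
        by (auto simp: verts_B_graph)
    qed
  qed
  also have "insert None (Some ` S) \<union> Range ?C =
      insert None (Some ` (insert w (S \<union> (\<lambda>u. u @ True # replicate (k - Suc m) False) ` U)))"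
    by auto
  finally show ?thesis .
qed

lemma replicate_diff_Suc:
  "n < k \<Longrightarrow> replicate (k - n) x = x # replicate (k - Suc n) x"
  by (metis Suc_diff_Suc replicate_Suc)

text \<open>The informed tree vertices are the roots of all copies of order \<open>k - n\<close>.
  Each round halves these copies; at \<open>n = k\<close> they are single vertices.\<close>

lemma informed_after_from_apex:
  assumes "n \<le> k"
  shows "informed_after (B_graph k) None (Suc n)
    (insert None (Some ` {u @ replicate (k - n) False | u. length u = n}))"
  using assms
proof (induction n)
  case 0
  have "informed_after (B_graph k) None (Suc 0)
      ({None} \<union> Range {(None :: bool list option, Some (replicate k False))})"
    by (rule informed_after_round[OF informed_after.start])
      (auto simp: single_valued_def verts_B_graph apex_edge_B_graph)
  then show ?case by (simp add: insert_commute)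
next
  case (Suc n)
  let ?S = "\<lambda>n. {u @ replicate (k - n) False | u. length u = n}"
  let ?U = "{u :: bool list. length u = n}"
  have n: "n < k" using Suc.prems by simp
  \<comment> \<open>The apex is idle here; a call to the informed vertex \<open>s\<close> has no effect.\<close>
  have "informed_after (B_graph k) None (Suc (Suc n)) (insert None (Some ` (insert (replicate k False)
      (?S n \<union> (\<lambda>u. u @ True # replicate (k - Suc n) False) ` ?U))))"
    by (rule informed_after_B_graph_round[OF Suc.IH]) (use n in auto)
  also have "insert (replicate k False) (?S n \<union> (\<lambda>u. u @ True # replicate (k - Suc n) False) ` ?U) =
      ?S (Suc n)" (is "?L = ?R")
  proof
    have "replicate k False = replicate (Suc n) False @ replicate (k - Suc n) False"
      using n by (simp flip: replicate_add replicate_Suc)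
    moreover have "u @ b # replicate (k - Suc n) False = (u @ [b]) @ replicate (k - Suc n) False"
      for u b by simp
    ultimately show "?L \<subseteq> ?R"
      using n by (fastforce simp: replicate_diff_Suc)
    show "?R \<subseteq> ?L"
    proof
      fix y
      assume "y \<in> ?R"
      then obtain u b where y: "y = u @ b # replicate (k - Suc n) False" "length u = n"
        by (auto simp: length_Suc_conv_rev)
      with n show "y \<in> ?L" by (cases b) (auto simp: replicate_diff_Suc)
    qed
  qed
  finally show ?case .
qed

text \<open>The invariant is as for the apex, except that in the copy of order \<open>k - n\<close>
  containing \<open>v\<close> only \<open>v\<close> is known to be informed. The apex repairs this
  by calling the root of the half of that copy without \<open>v\<close>; \<open>v\<close> itself is
  idle after its first call.\<close>

lemma informed_after_from_tree:
  assumes v: "length v = k" and "n \<le> k"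
  shows "informed_after (B_graph k) (Some v) (Suc n)
    (insert None (Some ` (insert v {u @ replicate (k - n) False | u. length u = n \<and> u \<noteq> take n v})))"
  using \<open>n \<le> k\<close>
proof (induction n)
  case 0
  have "informed_after (B_graph k) (Some v) (Suc 0) ({Some v} \<union> Range {(Some v, None)})"
    by (rule informed_after_round[OF informed_after.start])
      (use v in \<open>auto simp: single_valued_def verts_B_graph apex_edge_B_graph insert_commute\<close>)
  then show ?case by (simp add: insert_commute)
next
  case (Suc n)
  let ?S = "\<lambda>n. {u @ replicate (k - n) False | u. length u = n \<and> u \<noteq> take n v}"
  let ?U = "{u. length u = n \<and> u \<noteq> take n v}"
  \<comment> \<open>Flipping bit \<open>n\<close> of \<open>v\<close> selects the half that
    \<open>v\<close> is not in.\<close>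
  let ?w = "take n v @ (\<not> v ! n) # replicate (k - Suc n) False"
  have n: "n < k" using Suc.prems by simp
  have tk: "take (Suc n) v = take n v @ [v ! n]"
    using n v by (simp add: take_Suc_conv_app_nth)
  have "informed_after (B_graph k) (Some v) (Suc (Suc n)) (insert None (Some ` (insert ?w
      (insert v (?S n) \<union> (\<lambda>u. u @ True # replicate (k - Suc n) False) ` ?U))))"
    by (rule informed_after_B_graph_round[OF Suc.IH]) (use n v in auto)
  also have "insert ?w (insert v (?S n) \<union> (\<lambda>u. u @ True # replicate (k - Suc n) False) ` ?U) =
      insert v (?S (Suc n))" (is "?L = ?R")
  proof
    have mem: "u @ b # replicate (k - Suc n) False \<in> ?S (Suc n)"
      if "length u = n" "u \<noteq> take n v \<or> b \<noteq> v ! n" for u b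
      using that by (intro CollectI exI[of _ "u @ [b]"]) (auto simp: tk)
    show "?L \<subseteq> ?R"
      using mem[of "take n v" "\<not> v ! n"] mem n v by (auto simp: replicate_diff_Suc simp del: mem_Collect_eq)
    show "?R \<subseteq> ?L"
    proof
      fix y
      assume "y \<in> ?R"
      then consider "y = v" | u b where "y = u @ b # replicate (k - Suc n) False"
          "length u = n" "u \<noteq> take n v \<or> b \<noteq> v ! n"
        by (fastforce simp: length_Suc_conv_rev tk)
      then show "y \<in> ?L"
      proof cases
        case 1
        then show ?thesis by simp
      next
        case (2 u b)
        \<comment> \<open>If \<open>u = take n v\<close>, then \<open>y\<close> is
          \<open>?w\<close>. Otherwise \<open>b\<close> tells a root informed before
          (\<open>False\<close>) from its callee (\<open>True\<close>).\<close>
        with n show ?thesis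
          by (cases "u = take n v"; cases b) (auto simp: replicate_diff_Suc)
      qed
    qed
  qed
  finally show ?case .
qed

lemma broadcast_time_from_B_graph:
  assumes "a \<in> verts (B_graph k)"
  shows "broadcast_time_from a (B_graph k) = Suc k"
  unfolding broadcast_time_from_def
proof (rule Least_equality)
  show "informed_after (B_graph k) a (Suc k) (verts (B_graph k))"
  proof (cases a)
    case None
    then show ?thesis
      using informed_after_from_apex[of k k] by (simp add: verts_B_graph)
  next
    case (Some v)
    with assms have v: "length v = k" by (auto simp: verts_B_graph)
    \<comment> \<open>At \<open>n = k\<close> the exceptional copy is just \<open>v\<close>, which
      is informed.\<close>
    then have "insert v {u. length u = k \<and> u \<noteq> v} = {u. length u = k}" by auto
    with informed_after_from_tree[OF v order.refl] Some v show ?thesis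
      by (simp add: verts_B_graph)
  qed
next
  fix n
  assume "informed_after (B_graph k) a n (verts (B_graph k))"
  \<comment> \<open>The apex brings the number of vertices just above \<open>2 ^ k\<close>, so
    \<open>k\<close> rounds are too few.\<close>
  then have "(2 :: nat) ^ k < 2 ^ n"
    using card_informed_after[of "B_graph k" a n "verts (B_graph k)"]
    by (simp add: card_verts_B_graph Suc_le_eq del: power_strict_increasing_iff)
  then show "Suc k \<le> n" by simp
qed

lemma broadcast_time_B_graph: "broadcast_time (B_graph k) = Suc k"
proof -
  have "(\<lambda>v. broadcast_time_from v (B_graph k)) ` verts (B_graph k) = {Suc k}"
    using broadcast_time_from_B_graph by (auto simp: verts_B_graph image_iff)
  then show ?thesis by (simp add: broadcast_time_def)
qed

text \<open>This is 2 ^ k < 2 ^ k + 1 \<le> 2 ^ (k + 1), with equality on the right for k =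
  0.\<close>

lemma ceiling_log_two_power_plus_one: "\<lceil>log 2 (2 ^ k + 1)\<rceil> = int (Suc k)"
proof -
  have "\<lceil>log 2 (2 ^ k + 1)\<rceil> = int k + 1"
    by (subst ceiling_log_eq_powr_iff) (simp_all add: powr_add powr_realpow add_pos_nonneg)
  then show ?thesis by simp
qed

theorem theorem5:
  fixes k :: nat
  shows "series_parallel (B_graph k) \<and> broadcast_graph (B_graph k) \<and> card (verts (B_graph k)) = 2 ^ k + 1"
proof -
  obtain r V E where tree: "rooted_tree r V E" "None \<notin> V"
    and B: "B_graph k = (insert None V, E \<union> (\<lambda>x. {None, x}) ` V)"
    by (rule B_graph_cone)
  have simple: "simple_graph (B_graph k)"
    unfolding B by (rule simple_graph_cone[OF tree])
  then have "series_parallel (B_graph k)"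
    using sp_multigraph_cone[OF tree] by (simp add: series_parallel_def B)
  moreover have "connected_graph (B_graph k)"
    unfolding B by (rule connected_graph_cone) auto
  with simple have "broadcast_graph (B_graph k)"
    using ceiling_log_two_power_plus_one[of k]
    by (simp add: broadcast_graph_def broadcast_time_B_graph card_verts_B_graph add.commute)
  ultimately show ?thesis
    by (simp add: card_verts_B_graph)
qed

end
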